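(* Let $m\ge 1$, $n\ge 2$, and let $v_1,\dots,v_m\in(\mathbb{R}\cup\{\pm\infty\})^n$ be such that no $v_i$ equals $(+\infty,\dots,+\infty)$ or $(-\infty,\dots,-\infty)$. Let $w_i>0$ and $\lambda_i\in[0,1]$ for $i\in[m]$. Let $\mathcal{G}^-$ be the restricted network, $\mathrm{MCF}$ the min-cost flow problem over $\mathcal{G}^-$ (with an arbitrary real number $c$ assigned as the cost of all arcs of original cost $-\infty$), and $\mathcal{X}^*$ the tropical Fermat--Weber set, all as defined in the context. Then any optimal solution of $\mathrm{MCF}$ over $\mathcal{G}^-$ yields an optimal solution of the tropical Fermat--Weber problem. That is, if $\rho^*$ is an optimal flow of $\mathrm{MCF}$ over $\mathcal{G}^-$, then the set of points $x\in\mathbb{R}^n$ associated with $\rho^*$ (i.e. the $x$-parts of node potentials complementary to $\rho^*$, see context) is nonempty, and every such $x$ represents an element of $\mathcal{X}^*$.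
   Context: Notation: $[n]=\{1,\dots,n\}$; $V_{ij}\in\mathbb{R}\cup\{\pm\infty\}$ is the $j$-th coordinate of $v_i$; $\mathbf 1=(1,\dots,1)\in\mathbb{R}^n$; $\mathbf 1_j$ is the $j$-th standard basis vector. The tropical projective torus is the quotient $\mathbb{R}^n/\mathbb{R}\mathbf 1$. Parameters: $\alpha_i=(1-\lambda_i)n$, $\beta_i=\lambda_i n$, $\delta_i=2\lambda_i-1$, $\alpha_i^w=w_i\alpha_i$, $\beta_i^w=w_i\beta_i$, $\delta^w_{tot}=\sum_i w_i\delta_i$. Background: for finite data the tropical Fermat--Weber problem is to minimize over $x$ the sum $\sum_i w_i\,\mathrm{d}^{\lambda_i}_{\mathrm{tr}}(x,v_i)$, where $\mathrm{d}_{\mathrm{tr}}^\lambda(x,y)=\lambda n\max_j(x_j-y_j)-(1-\lambda)n\min_j(x_j-y_j)+(1-2\lambda)\sum_j(x_j-y_j)$. For possibly non-finite data, its solution set is defined by the first-order condition as follows. Tropical Fermat--Weber set: for $x\in\mathbb{R}^n$ put $M_i(x)=\operatorname{argmax}_j(V_{ij}-x_j)$ and $N_i(x)=\operatorname{argmin}_j(V_{ij}-x_j)$ (sets of all maximizing, resp. minimizing, indices in $\mathbb{R}\cup\{\pm\infty\}$), and $$\partial f(x)=\sum_{i=1}^m w_i\,\mathrm{conv}\{\alpha_i\mathbf 1_j-\beta_i\mathbf 1_{j'}+\delta_i\mathbf 1 : j\in M_i(x),\ j'\in N_i(x)\}$$ (Minkowski sum). Then $\mathcal{X}^*=\{x\in\mathbb{R}^n/\mathbb{R}\mathbf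 1 : \mathbf 0\in\partial f(x)\}$. The elements of $\mathcal{X}^*$ are the (finite) optimal solutions of the tropical Fermat--Weber problem. Restricted network $\mathcal{G}^-$: its nodes are $\phi_1,\dots,\phi_m$, $x_1,\dots,x_n$, $\psi_1,\dots,\psi_m$. Its arcs are $\mathcal{A}^-_{\max}\cup\mathcal{A}^-_{\min}$, where $(i,j)$ denotes an arc from $\phi_i$ to $x_j$ and $(j,i')$ denotes an arc from $x_j$ to $\psi_i$, and $$\mathcal{A}^-_{\max}=\{(i,j):V_{ij}=-\infty\}\cup\{(i,j):\min_kV_{ik}>-\infty,\ V_{ij}<+\infty\},$$ $$\mathcal{A}^-_{\min}=\{(j,i'):V_{ij}=+\infty\}\cup\{(j,i'):\max_kV_{ik}<+\infty,\ V_{ij}>-\infty\}.$$ The arc $(i,j)$ has cost $c_{ij}=V_{ij}$ and the arc $(j,i')$ has cost $c_{ji'}=-V_{ij}$; every arc whose cost would be $-\infty$ is instead given the cost $c$, where $c\in\mathbb{R}$ is a fixed arbitrary number. $\mathrm{MCF}$ over $\mathcal{G}^-$: minimize $\sum_{(i,j)\in\mathcal{A}^-_{\max}}c_{ij}\rho_{ij}+\sum_{(j,i')\in\mathcal{A}^-_{\min}}c_{ji'}\rho_{ji'}$ over $\rho\ge0$ subject to $\sum_j\rho_{ij}=\beta_i^w$ for $i\in[m]$, $\sum_j\rho_{ji'}=\alpha_i^w$ for $i\in[m]$, and $\sum_i\rho_{ij}-\sum_i\rho_{ji'}=\delta^w_{tot}$ for $j\in[n]$ (sums over existing arcs). Points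 associated with an optimal flow $\rho^*$: those $x\in\mathbb{R}^n$ for which there exist $\phi,\psi\in\mathbb{R}^m$ with $x_j-\phi_i\le c_{ij}$ for all $(i,j)\in\mathcal{A}^-_{\max}$, with equality if $\rho^*_{ij}>0$, and $\psi_i-x_j\le c_{ji'}$ for all $(j,i')\in\mathcal{A}^-_{\min}$, with equality if $\rho^*_{ji'}>0$. *)

theory Defs
  imports "HOL-Analysis.Analysis"
begin

text \<open>
  The index sets \<open>[m]\<close> and \<open>[n]\<close> are the finite (hence nonempty) types \<open>'m\<close> and \<open>'n\<close>,
  so that \<open>n = CARD('n)\<close>; the coordinate \<open>V\<^sub>i\<^sub>j\<close> is \<open>V i $ j\<close>.
  The constant \<open>1\<close> of type \<open>real ^ 'n\<close> is the all-ones vector.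
\<close>

definition torus_rel :: "((real ^ 'n) \<times> (real ^ 'n)) set" where
  "torus_rel = {(x, y). \<exists>t::real. y = x + t *\<^sub>R 1}"

definition torus :: "(real ^ 'n) set set" where
  "torus = UNIV // torus_rel"

definition torus_class :: "real ^ 'n \<Rightarrow> (real ^ 'n) set" where
  "torus_class x = torus_rel `` {x}"

definition alpha :: "'n::finite itself \<Rightarrow> real \<Rightarrow> real" where
  "alpha _ l = (1 - l) * real CARD('n)"

definition beta :: "'n::finite itself \<Rightarrow> real \<Rightarrow> real" where
  "beta _ l = l * real CARD('n)"

definition delta :: "real \<Rightarrow> real" where
  "delta l = 2 * l - 1"

definition delta_tot :: "('m::finite \<Rightarrow> real) \<Rightarrow> ('m \<Rightarrow> real) \<Rightarrow> real" where
  "delta_tot w lam = (\<Sum>i\<in>UNIV. w i * delta (lam i))"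

definition argmax_set :: "('m \<Rightarrow> ereal ^ 'n) \<Rightarrow> 'm \<Rightarrow> real ^ 'n \<Rightarrow> 'n set" where
  "argmax_set V i x = {j. is_arg_max (\<lambda>k. V i $ k - ereal (x $ k)) (\<lambda>_. True) j}"

definition argmin_set :: "('m \<Rightarrow> ereal ^ 'n) \<Rightarrow> 'm \<Rightarrow> real ^ 'n \<Rightarrow> 'n set" where
  "argmin_set V i x = {j. is_arg_min (\<lambda>k. V i $ k - ereal (x $ k)) (\<lambda>_. True) j}"

text \<open>The outer sum is the Minkowski sum of sets.\<close>

definition subdiff ::
    "('m::finite \<Rightarrow> ereal ^ 'n) \<Rightarrow> ('m \<Rightarrow> real) \<Rightarrow> ('m \<Rightarrow> real) \<Rightarrow> real ^ 'n \<Rightarrow> (real ^ 'n) set" where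
  "subdiff V w lam x =
     (\<Sum>i\<in>UNIV. (\<lambda>y. w i *\<^sub>R y) `
        (convex hull {alpha TYPE('n) (lam i) *\<^sub>R axis j 1 - beta TYPE('n) (lam i) *\<^sub>R axis j' 1
                       + delta (lam i) *\<^sub>R 1 | j j'. j \<in> argmax_set V i x \<and> j' \<in> argmin_set V i x}))"

text \<open>
  The condition \<open>0 \<in> subdiff V w lam x\<close> does not depend on the representative \<open>x\<close>
  of a point of the torus, see \<open>subdiff_translate\<close> and \<open>torus_class_in_FW_set_iff\<close> below.
\<close>

definition FW_set ::
    "('m::finite \<Rightarrow> ereal ^ 'n) \<Rightarrow> ('m \<Rightarrow> real) \<Rightarrow> ('m \<Rightarrow> real) \<Rightarrow> (real ^ 'n) set set" where
  "FW_set V w lam = {\<xi> \<in> torus. \<forall>x\<in>\<xi>. 0 \<in> subdiff V w lam x}"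

lemma ereal_diff_translate_less_iff:
  "a - ereal (x + t) < b - ereal (y + t) \<longleftrightarrow> a - ereal x < b - ereal y"
  by (cases a; cases b) auto

lemma subdiff_translate: "subdiff V w lam (x + t *\<^sub>R 1) = subdiff V w lam x"
  by (simp add: subdiff_def argmax_set_def argmin_set_def is_arg_max_def is_arg_min_def
      ereal_diff_translate_less_iff)

lemma torus_class_in_FW_set_iff: "torus_class x \<in> FW_set V w lam \<longleftrightarrow> 0 \<in> subdiff V w lam x"
proof -
  have "x + 0 *\<^sub>R 1 \<in> torus_class x"
    unfolding torus_class_def torus_rel_def by blast
  moreover have "torus_class x \<in> torus"
    unfolding torus_class_def torus_def by (simp add: quotientI)
  ultimately show ?thesis
    by (auto simp: FW_set_def torus_class_def torus_rel_def subdiff_translate)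
qed

datatype ('m, 'n) node = Phi 'm | Node_X 'n | Psi 'm

type_synonym ('m, 'n) arc = "('m, 'n) node \<times> ('m, 'n) node"

definition arcs_max :: "('m \<Rightarrow> ereal ^ 'n) \<Rightarrow> ('m, 'n) arc set" where
  "arcs_max V =
     {(Phi i, Node_X j) | i j. V i $ j = -\<infinity>} \<union>
     {(Phi i, Node_X j) | i j. Min (range (\<lambda>k. V i $ k)) > -\<infinity> \<and> V i $ j < \<infinity>}"

definition arcs_min :: "('m \<Rightarrow> ereal ^ 'n) \<Rightarrow> ('m, 'n) arc set" where
  "arcs_min V =
     {(Node_X j, Psi i) | i j. V i $ j = \<infinity>} \<union>
     {(Node_X j, Psi i) | i j. Max (range (\<lambda>k. V i $ k)) < \<infinity> \<and> V i $ j > -\<infinity>}"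

definition original_cost :: "('m \<Rightarrow> ereal ^ 'n) \<Rightarrow> ('m, 'n) arc \<Rightarrow> ereal" where
  "original_cost V a =
     (case a of (Phi i, Node_X j) \<Rightarrow> V i $ j | (Node_X j, Psi i) \<Rightarrow> - (V i $ j) | _ \<Rightarrow> 0)"

text \<open>No arc of the network has original cost \<open>\<infinity>\<close>.\<close>

definition arc_cost :: "('m \<Rightarrow> ereal ^ 'n) \<Rightarrow> real \<Rightarrow> ('m, 'n) arc \<Rightarrow> real" where
  "arc_cost V c a = (if original_cost V a = -\<infinity> then c else real_of_ereal (original_cost V a))"

definition MCF_feasible ::
    "('m::finite \<Rightarrow> ereal ^ 'n) \<Rightarrow> ('m \<Rightarrow> real) \<Rightarrow> ('m \<Rightarrow> real) \<Rightarrow> (('m, 'n) arc \<Rightarrow> real) \<Rightarrow> bool" where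
  "MCF_feasible V w lam \<rho> \<longleftrightarrow>
     (\<forall>a\<in>arcs_max V \<union> arcs_min V. 0 \<le> \<rho> a) \<and>
     (\<forall>i. (\<Sum>j | (Phi i, Node_X j) \<in> arcs_max V. \<rho> (Phi i, Node_X j))
            = w i * beta TYPE('n) (lam i)) \<and>
     (\<forall>i. (\<Sum>j | (Node_X j, Psi i) \<in> arcs_min V. \<rho> (Node_X j, Psi i))
            = w i * alpha TYPE('n) (lam i)) \<and>
     (\<forall>j. (\<Sum>i | (Phi i, Node_X j) \<in> arcs_max V. \<rho> (Phi i, Node_X j))
            - (\<Sum>i | (Node_X j, Psi i) \<in> arcs_min V. \<rho> (Node_X j, Psi i))
            = delta_tot w lam)"

definition MCF_cost :: "('m::finite \<Rightarrow> ereal ^ 'n) \<Rightarrow> real \<Rightarrow> (('m, 'n) arc \<Rightarrow> real) \<Rightarrow> real" where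
  "MCF_cost V c \<rho> =
     (\<Sum>a\<in>arcs_max V. arc_cost V c a * \<rho> a) + (\<Sum>a\<in>arcs_min V. arc_cost V c a * \<rho> a)"

definition MCF_optimal ::
    "('m::finite \<Rightarrow> ereal ^ 'n) \<Rightarrow> ('m \<Rightarrow> real) \<Rightarrow> ('m \<Rightarrow> real) \<Rightarrow> real
      \<Rightarrow> (('m, 'n) arc \<Rightarrow> real) \<Rightarrow> bool" where
  "MCF_optimal V w lam c \<rho> \<longleftrightarrow> is_arg_min (MCF_cost V c) (MCF_feasible V w lam) \<rho>"

definition associated_points ::
    "('m::finite \<Rightarrow> ereal ^ 'n) \<Rightarrow> real \<Rightarrow> (('m, 'n) arc \<Rightarrow> real) \<Rightarrow> (real ^ 'n) set" where
  "associated_points V c \<rho> =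
     {x. \<exists>\<phi> \<psi> :: 'm \<Rightarrow> real.
        (\<forall>i j. (Phi i, Node_X j) \<in> arcs_max V \<longrightarrow>
           x $ j - \<phi> i \<le> arc_cost V c (Phi i, Node_X j) \<and>
           (\<rho> (Phi i, Node_X j) > 0 \<longrightarrow> x $ j - \<phi> i = arc_cost V c (Phi i, Node_X j))) \<and>
        (\<forall>i j. (Node_X j, Psi i) \<in> arcs_min V \<longrightarrow>
           \<psi> i - x $ j \<le> arc_cost V c (Node_X j, Psi i) \<and>
           (\<rho> (Node_X j, Psi i) > 0 \<longrightarrow> \<psi> i - x $ j = arc_cost V c (Node_X j, Psi i)))}"

end

theory Submission
  imports Defs
begin

text \<open>
  Complementary node potentials are an optimal dual solution; they come from Farkas' lemma applied
  to the cone of feasible perturbations of the optimal flow. Conversely, complementary slackness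
  says that the arcs carrying flow out of \<open>Phi i\<close> end in minimizers of \<open>V\<^sub>i\<^sub>j - x\<^sub>j\<close>, and those
  carrying flow into \<open>Psi i\<close> start in maximizers. Normalizing the flows at \<open>Phi i\<close> and \<open>Psi i\<close>
  to total mass one gives the convex coefficients of an element of the \<open>i\<close>-th summand of the
  subdifferential, and flow conservation at the nodes \<open>Node_X j\<close> says that these elements add up
  to \<open>0\<close>.
\<close>

section \<open>Complementary slackness\<close>

text \<open>Where \<open>r\<close> is positive, every small change keeps it nonnegative; where it
  vanishes, the sign of \<open>d\<close> does. Finitely many such conditions hold together for all
  small \<open>t > 0\<close>.\<close>

lemma exists_nonneg_perturbation:
  fixes r d :: "'k \<Rightarrow> real"
  assumes "finite S" "\<And>a. a \<in> S \<Longrightarrow> 0 \<le> r a" "\<And>a. a \<in> S \<Longrightarrow> r a = 0 \<Longrightarrow> 0 \<le> d a"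
  shows "\<exists>t>0. \<forall>a\<in>S. 0 \<le> r a + t * d a"
proof -
  have "\<forall>\<^sub>F t in at_right 0. 0 \<le> r a + t * d a" if a: "a \<in> S" for a
  proof (cases "r a = 0")
    case True
    show ?thesis
      using eventually_at_right_less[of 0] by eventually_elim (use True assms(3) a in simp)
  next
    case False
    have "((\<lambda>t. r a + t * d a) \<longlongrightarrow> r a + 0 * d a) (at_right 0)"
      by (intro tendsto_intros)
    moreover have "r a + 0 * d a > 0"
      using False assms(2)[OF a] by simp
    ultimately have "\<forall>\<^sub>F t in at_right 0. 0 < r a + t * d a"
      by (rule order_tendstoD)
    then show ?thesis
      by eventually_elim simp
  qed
  then have "\<forall>\<^sub>F t in at_right 0. \<forall>a\<in>S. 0 \<le> r a + t * d a"
    using \<open>finite S\<close> by (simp add: eventually_ball_finite)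
  then have "\<forall>\<^sub>F t in at_right (0::real). 0 < t \<and> (\<forall>a\<in>S. 0 \<le> r a + t * d a)"
    using eventually_at_right_less[of 0] by eventually_elim simp
  then show ?thesis
    by (metis (no_types, lifting) eventually_happens' trivial_limit_at_right_real)
qed

text \<open>A finitely generated cone is closed, so a hyperplane strictly separates \<open>z\<close>
  from it; a linear form that is bounded below on a cone is nonnegative there.\<close>

lemma farkas:
  fixes G :: "'a::euclidean_space set"
  assumes "finite G" "z \<notin> convex_cone hull G"
  shows "\<exists>y. y \<bullet> z < 0 \<and> (\<forall>g\<in>G. 0 \<le> y \<bullet> g)"
proof -
  let ?K = "convex_cone hull G"
  obtain y b where y: "y \<bullet> z < b" "\<forall>k\<in>?K. b < y \<bullet> k"
    using separating_hyperplane_closed_point[OF convex_convex_cone_hull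
        closed_convex_cone_hull[OF assms(1)] assms(2)] by blast
  have "b < 0"
    using y(2) convex_cone_hull_contains_0[of G] by force
  have "0 \<le> y \<bullet> g" if "g \<in> G" for g
  proof (rule ccontr)
    assume "\<not> 0 \<le> y \<bullet> g"
    then have neg: "y \<bullet> g < 0"
      by simp
    \<comment> \<open>This positive multiple of \<open>g\<close> lies exactly on the hyperplane
      \<open>y \<bullet> k = b\<close>, which the cone must not touch.\<close>
    then have "(b / (y \<bullet> g)) *\<^sub>R g \<in> ?K"
      using \<open>b < 0\<close> that by (intro convex_cone_hull_mul hull_inc) (auto simp: zero_le_divide_iff)
    then have "b < y \<bullet> ((b / (y \<bullet> g)) *\<^sub>R g)"
      using y(2) by blast
    then show False
      using neg by simp
  qed
  then show ?thesis
    using y(1) \<open>b < 0\<close> by (intro exI[of _ y]) auto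
qed

text \<open>A direction that is nonnegative wherever \<open>r\<close> vanishes can be followed a
  little way from \<open>r\<close>, so by optimality it cannot preserve the constraints and lower
  the cost. Farkas' lemma turns this obstruction into the multipliers \<open>y\<close>.\<close>

lemma LP_complementary_slackness:
  fixes A :: "'k \<Rightarrow> 'a::euclidean_space" and c r :: "'k \<Rightarrow> real"
  assumes "finite S"
    and nonneg: "\<And>a. a \<in> S \<Longrightarrow> 0 \<le> r a"
    and opt: "\<And>r'. \<lbrakk>\<And>a. a \<in> S \<Longrightarrow> 0 \<le> r' a; (\<Sum>a\<in>S. r' a *\<^sub>R A a) = (\<Sum>a\<in>S. r a *\<^sub>R A a)\<rbrakk>
              \<Longrightarrow> (\<Sum>a\<in>S. c a * r a) \<le> (\<Sum>a\<in>S. c a * r' a)"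
  shows "\<exists>y. \<forall>a\<in>S. y \<bullet> A a \<le> c a \<and> (0 < r a \<longrightarrow> y \<bullet> A a = c a)"
proof -
  \<comment> \<open>Pairing column and cost makes \<open>\<Sum>a\<in>S. d a *\<^sub>R F a\<close>
    the change of both along a direction \<open>d\<close>.\<close>
  define F where "F a = (A a, c a)" for a
  \<comment> \<open>Coordinates with \<open>r a > 0\<close> may move both ways and so contribute
    both signs; this is what yields equality there in the end. \<open>D\<close> holds the admissible
    directions and \<open>C\<close> their effects.\<close>
  define G where "G = F ` S \<union> (\<lambda>a. - F a) ` {a \<in> S. 0 < r a}"
  define D where "D = {d :: 'k \<Rightarrow> real. \<forall>a\<in>S. r a = 0 \<longrightarrow> 0 \<le> d a}"
  define C where "C = (\<lambda>d. \<Sum>a\<in>S. d a *\<^sub>R F a) ` D"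
  have "convex_cone C"
    unfolding convex_cone_iff
  proof (intro conjI ballI allI impI)
    have "(\<lambda>_. 0) \<in> D"
      by (simp add: D_def)
    then show "0 \<in> C"
      unfolding C_def by (rule rev_image_eqI) simp
  next
    fix u v assume "u \<in> C" "v \<in> C"
    then obtain d e where de: "d \<in> D" "e \<in> D" "u = (\<Sum>a\<in>S. d a *\<^sub>R F a)" "v = (\<Sum>a\<in>S. e a *\<^sub>R F a)"
      unfolding C_def by blast
    then have "(\<lambda>a. d a + e a) \<in> D"
      by (simp add: D_def)
    then show "u + v \<in> C"
      unfolding C_def by (rule rev_image_eqI) (simp add: de sum.distrib scaleR_add_left)
  next
    fix u and t :: real assume "u \<in> C" "0 \<le> t"
    then obtain d where d: "d \<in> D" "u = (\<Sum>a\<in>S. d a *\<^sub>R F a)"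
      unfolding C_def by blast
    then have "(\<lambda>a. t * d a) \<in> D"
      using \<open>0 \<le> t\<close> by (simp add: D_def)
    then show "t *\<^sub>R u \<in> C"
      unfolding C_def by (rule rev_image_eqI) (simp add: d scaleR_sum_right)
  qed
  moreover have "G \<subseteq> C"
  proof -
    have delta: "(\<Sum>a\<in>S. (if a = b then s else 0) *\<^sub>R F a) = s *\<^sub>R F b" if "b \<in> S" for b s
      using that \<open>finite S\<close> by (simp add: if_distrib[of "\<lambda>s. s *\<^sub>R _"] cong: if_cong)
    have "s *\<^sub>R F b \<in> C" if "b \<in> S" "r b = 0 \<longrightarrow> 0 \<le> s" for b s
      unfolding C_def
      by (rule rev_image_eqI[of "\<lambda>a. if a = b then s else 0"]) (use that delta in \<open>auto simp: D_def\<close>)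
    from this[of _ 1] this[of _ "-1"] show ?thesis
      by (auto simp: G_def)
  qed
  ultimately have hull: "convex_cone hull G \<subseteq> C"
    by (simp add: hull_minimal)
  \<comment> \<open>A preimage of \<open>(0, -1)\<close> would be an admissible direction that keeps
    the constraints and lowers the cost at unit rate.\<close>
  have "(0, -1) \<notin> C"
  proof
    assume "(0, -1) \<in> C"
    then obtain d where d: "d \<in> D" "(\<Sum>a\<in>S. d a *\<^sub>R A a) = 0" "(\<Sum>a\<in>S. c a * d a) = -1"
      by (auto simp: C_def F_def prod_eq_iff fst_sum snd_sum mult.commute)
    obtain t where t: "t > 0" "\<forall>a\<in>S. 0 \<le> r a + t * d a"
      using exists_nonneg_perturbation[of S r d] \<open>finite S\<close> nonneg d(1) by (auto simp: D_def)
    have "(\<Sum>a\<in>S. (r a + t * d a) *\<^sub>R A a) = (\<Sum>a\<in>S. r a *\<^sub>R A a) + t *\<^sub>R (\<Sum>a\<in>S. d a *\<^sub>R A a)"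
      by (simp add: scaleR_add_left sum.distrib scaleR_sum_right)
    then have "(\<Sum>a\<in>S. c a * r a) \<le> (\<Sum>a\<in>S. c a * (r a + t * d a))"
      using t by (intro opt) (auto simp: d)
    also have "\<dots> = (\<Sum>a\<in>S. c a * r a) + t * (\<Sum>a\<in>S. c a * d a)"
      by (simp add: algebra_simps sum.distrib sum_distrib_left)
    finally show False
      using t(1) d(3) by simp
  qed
  moreover have "finite G"
    using \<open>finite S\<close> by (simp add: G_def)
  ultimately obtain q where q: "q \<bullet> (0, -1) < 0" "\<forall>g\<in>G. 0 \<le> q \<bullet> g"
    using farkas[of G "(0, -1)"] hull by blast
  obtain p s where ps: "q = (p, s)"
    by (cases q)
  have "s > 0"
    using q(1) by (simp add: ps)
  \<comment> \<open>\<open>0 \<le> q \<bullet> F a\<close> reads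
    \<open>0 \<le> p \<bullet> A a + s * c a\<close>; dividing by \<open>- s\<close> gives the bound
    for the multiplier \<open>- p / s\<close>.\<close>
  show ?thesis
  proof (intro exI[of _ "- (1 / s) *\<^sub>R p"] ballI conjI impI)
    fix a assume a: "a \<in> S"
    then have "0 \<le> q \<bullet> F a"
      using q(2) by (simp add: G_def)
    then show le: "(- (1 / s) *\<^sub>R p) \<bullet> A a \<le> c a"
      using \<open>s > 0\<close> by (simp add: ps F_def field_simps)
    assume "0 < r a"
    then have "0 \<le> q \<bullet> (- F a)"
      using q(2) a unfolding G_def by blast
    then have "c a \<le> (- (1 / s) *\<^sub>R p) \<bullet> A a"
      using \<open>s > 0\<close> by (simp add: ps F_def field_simps)
    with le show "(- (1 / s) *\<^sub>R p) \<bullet> A a = c a"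
      by simp
  qed
qed

section \<open>Node potentials\<close>

lemma Phi_X_arc_iff:
  fixes V :: "'m::finite \<Rightarrow> ereal ^ 'n"
  shows "(Phi i, Node_X j) \<in> arcs_max V \<longleftrightarrow>
     V i $ j = -\<infinity> \<or> (\<forall>k. V i $ k > -\<infinity>) \<and> V i $ j < \<infinity>"
  unfolding arcs_max_def by (subst Min_gr_iff) auto

lemma X_Psi_arc_iff:
  fixes V :: "'m::finite \<Rightarrow> ereal ^ 'n"
  shows "(Node_X j, Psi i) \<in> arcs_min V \<longleftrightarrow>
     V i $ j = \<infinity> \<or> (\<forall>k. V i $ k < \<infinity>) \<and> V i $ j > -\<infinity>"
  unfolding arcs_min_def by (subst Max_less_iff) auto

lemma sum_arcs_max:
  fixes V :: "'m::finite \<Rightarrow> ereal ^ 'n" and g :: "('m, 'n) arc \<Rightarrow> 'b::comm_monoid_add"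
  shows "(\<Sum>a\<in>arcs_max V. g a)
    = (\<Sum>i\<in>UNIV. \<Sum>j | (Phi i, Node_X j) \<in> arcs_max V. g (Phi i, Node_X j))"
proof -
  let ?I = "SIGMA i:UNIV. {j. (Phi i, Node_X j) \<in> arcs_max V}"
  let ?h = "\<lambda>(i, j). (Phi i, Node_X j)"
  have arcs: "?h ` ?I = arcs_max V"
    by (auto simp: arcs_max_def image_iff)
  have "(\<Sum>a\<in>?h ` ?I. g a) = (\<Sum>p\<in>?I. g (?h p))"
    by (subst sum.reindex) (auto simp: inj_on_def)
  then show ?thesis
    unfolding arcs
    by (simp add: sum.Sigma case_prod_unfold)
qed

lemma sum_arcs_min:
  fixes V :: "'m::finite \<Rightarrow> ereal ^ 'n" and g :: "('m, 'n) arc \<Rightarrow> 'b::comm_monoid_add"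
  shows "(\<Sum>a\<in>arcs_min V. g a)
    = (\<Sum>i\<in>UNIV. \<Sum>j | (Node_X j, Psi i) \<in> arcs_min V. g (Node_X j, Psi i))"
proof -
  let ?I = "SIGMA i:UNIV. {j. (Node_X j, Psi i) \<in> arcs_min V}"
  let ?h = "\<lambda>(i, j). (Node_X j, Psi i)"
  have arcs: "?h ` ?I = arcs_min V"
    by (auto simp: arcs_min_def image_iff)
  have "(\<Sum>a\<in>?h ` ?I. g a) = (\<Sum>p\<in>?I. g (?h p))"
    by (subst sum.reindex) (auto simp: inj_on_def)
  then show ?thesis
    unfolding arcs
    by (simp add: sum.Sigma case_prod_unfold)
qed

lemma finite_arcs: "finite (arcs_max V)" "finite (arcs_min V)"
  for V :: "'m::finite \<Rightarrow> ereal ^ 'n"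
proof -
  have "arcs_max V \<subseteq> (\<lambda>(i, j). (Phi i, Node_X j)) ` UNIV"
       "arcs_min V \<subseteq> (\<lambda>(i, j). (Node_X j, Psi i)) ` UNIV"
    by (auto simp: arcs_max_def arcs_min_def image_iff)
  then show "finite (arcs_max V)" "finite (arcs_min V)"
    by (simp_all add: finite_subset)
qed

lemma sum_arcs:
  fixes V :: "'m::finite \<Rightarrow> ereal ^ 'n" and g :: "('m, 'n) arc \<Rightarrow> 'b::comm_monoid_add"
  shows "(\<Sum>a\<in>arcs_max V \<union> arcs_min V. g a) = (\<Sum>a\<in>arcs_max V. g a) + (\<Sum>a\<in>arcs_min V. g a)"
  by (rule sum.union_disjoint) (auto simp: finite_arcs, auto simp: arcs_max_def arcs_min_def)

text \<open>A column of the node-arc incidence matrix, in blocks for the \<open>Phi\<close>,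
  \<open>Node_X\<close> and \<open>Psi\<close> nodes: -1 at the tail, 1 at the head. Its inner
  product with a potential is head minus tail, as in the inequalities of
  \<open>associated_points\<close>.\<close>

definition incidence :: "('m::finite, 'n::finite) arc \<Rightarrow> (real ^ 'm) \<times> (real ^ 'n) \<times> (real ^ 'm)" where
  "incidence a = (case a of
      (Phi i, Node_X j) \<Rightarrow> (- axis i 1, axis j 1, 0)
    | (Node_X j, Psi i) \<Rightarrow> (0, - axis j 1, axis i 1)
    | _ \<Rightarrow> 0)"

lemma incidence_simps [simp]:
  "incidence (Phi i, Node_X j) = (- axis i 1, axis j 1, 0)"
  "incidence (Node_X j, Psi i) = (0, - axis j 1, axis i 1)"
  by (simp_all add: incidence_def)

text \<open>Links the vector constraint of the linear program to \<open>MCF_feasible\<close>: flows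
  with equal sums satisfy the same balance equations. The first block is negated because flow leaves
  the \<open>Phi\<close> nodes.\<close>

lemma net_flow_eq:
  fixes V :: "'m::finite \<Rightarrow> ereal ^ 'n" and \<rho> :: "('m, 'n) arc \<Rightarrow> real"
  shows "(\<Sum>a\<in>arcs_max V \<union> arcs_min V. \<rho> a *\<^sub>R incidence a) =
    (\<chi> i. - (\<Sum>j | (Phi i, Node_X j) \<in> arcs_max V. \<rho> (Phi i, Node_X j)),
     \<chi> j. (\<Sum>i | (Phi i, Node_X j) \<in> arcs_max V. \<rho> (Phi i, Node_X j))
            - (\<Sum>i | (Node_X j, Psi i) \<in> arcs_min V. \<rho> (Node_X j, Psi i)),
     \<chi> i. \<Sum>j | (Node_X j, Psi i) \<in> arcs_min V. \<rho> (Node_X j, Psi i))"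
proof -
  \<comment> \<open>The double sums always run over \<open>i\<close> outside. A \<open>Phi\<close>
    or \<open>Psi\<close> coordinate selects one outer index (\<open>row\<close>), a
    \<open>Node_X\<close> coordinate one inner index (\<open>col\<close>).\<close>
  have row: "(\<Sum>i\<in>UNIV. \<Sum>j | P i j. f i j * axis i 1 $ k) = (\<Sum>j | P k j. f k j)"
    for P :: "'m \<Rightarrow> 'n \<Rightarrow> bool" and f :: "'m \<Rightarrow> 'n \<Rightarrow> real" and k
  proof -
    have "(\<Sum>i\<in>UNIV. \<Sum>j | P i j. f i j * axis i 1 $ k)
        = (\<Sum>i\<in>UNIV. if i = k then \<Sum>j | P i j. f i j else 0)"
      by (rule sum.cong) (auto simp: axis_def)
    then show ?thesis
      by simp
  qed
  have col: "(\<Sum>i\<in>UNIV. \<Sum>j | P i j. f i j * axis j 1 $ k) = (\<Sum>i | P i k. f i k)"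
    for P :: "'m \<Rightarrow> 'n \<Rightarrow> bool" and f :: "'m \<Rightarrow> 'n \<Rightarrow> real" and k
  proof -
    have "(\<Sum>j | P i j. f i j * axis j 1 $ k) = (if P i k then f i k else 0)" for i
    proof -
      have "(\<Sum>j | P i j. f i j * axis j 1 $ k) = (\<Sum>j | P i j. if j = k then f i j else 0)"
        by (rule sum.cong) (auto simp: axis_def)
      then show ?thesis
        by simp
    qed
    then show ?thesis
      using sum.inter_filter[of UNIV "\<lambda>i. f i k" "\<lambda>i. P i k"] by simp
  qed
  show ?thesis
    by (simp add: sum_arcs sum_arcs_max sum_arcs_min prod_eq_iff fst_sum snd_sum vec_eq_iff
        sum_negf row col)
qed

text \<open>The flow problem is a linear program with columns \<open>incidence a\<close>, and its
  multiplier vector splits into the potentials \<open>\<phi>\<close>, \<open>x\<close>,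
  \<open>\<psi>\<close>.\<close>

lemma optimal_flow_has_potentials:
  fixes V :: "'m::finite \<Rightarrow> ereal ^ 'n"
  assumes "MCF_optimal V w lam c \<rho>"
  shows "associated_points V c \<rho> \<noteq> {}"
proof -
  let ?S = "arcs_max V \<union> arcs_min V"
  have feas: "MCF_feasible V w lam \<rho>"
    and min: "\<And>\<rho>'. MCF_feasible V w lam \<rho>' \<Longrightarrow> MCF_cost V c \<rho> \<le> MCF_cost V c \<rho>'"
    using assms by (auto simp: MCF_optimal_def is_arg_min_linorder)
  have "\<exists>y. \<forall>a\<in>?S. y \<bullet> incidence a \<le> arc_cost V c a
                   \<and> (0 < \<rho> a \<longrightarrow> y \<bullet> incidence a = arc_cost V c a)"
  proof (rule LP_complementary_slackness)
    show "finite ?S"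
      by (simp add: finite_arcs)
    show "0 \<le> \<rho> a" if "a \<in> ?S" for a
      using feas that unfolding MCF_feasible_def by blast
    fix \<rho>' assume "\<And>a. a \<in> ?S \<Longrightarrow> 0 \<le> \<rho>' a"
      and "(\<Sum>a\<in>?S. \<rho>' a *\<^sub>R incidence a) = (\<Sum>a\<in>?S. \<rho> a *\<^sub>R incidence a)"
    then have "MCF_feasible V w lam \<rho>'"
      using feas by (simp add: net_flow_eq MCF_feasible_def vec_eq_iff)
    from min[OF this] show "(\<Sum>a\<in>?S. arc_cost V c a * \<rho> a) \<le> (\<Sum>a\<in>?S. arc_cost V c a * \<rho>' a)"
      by (simp add: MCF_cost_def sum_arcs)
  qed
  then obtain \<phi> x \<psi> where y: "\<And>a. a \<in> ?S \<Longrightarrow> (\<phi>, x, \<psi>) \<bullet> incidence a \<le> arc_cost V c a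
                   \<and> (0 < \<rho> a \<longrightarrow> (\<phi>, x, \<psi>) \<bullet> incidence a = arc_cost V c a)"
    by (metis prod.exhaust)
  have "x \<in> associated_points V c \<rho>"
    unfolding associated_points_def mem_Collect_eq
  proof (rule exI[of _ "\<lambda>i. \<phi> $ i"], rule exI[of _ "\<lambda>i. \<psi> $ i"], intro conjI allI impI)
    fix i j assume "(Phi i, Node_X j) \<in> arcs_max V"
    with y[of "(Phi i, Node_X j)"]
    show "x $ j - \<phi> $ i \<le> arc_cost V c (Phi i, Node_X j)"
      and "0 < \<rho> (Phi i, Node_X j) \<Longrightarrow> x $ j - \<phi> $ i = arc_cost V c (Phi i, Node_X j)"
      by (simp_all add: inner_axis)
  next
    fix i j assume "(Node_X j, Psi i) \<in> arcs_min V"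
    with y[of "(Node_X j, Psi i)"]
    show "\<psi> $ i - x $ j \<le> arc_cost V c (Node_X j, Psi i)"
      and "0 < \<rho> (Node_X j, Psi i) \<Longrightarrow> \<psi> $ i - x $ j = arc_cost V c (Node_X j, Psi i)"
      by (simp_all add: inner_axis)
  qed
  then show ?thesis
    by blast
qed

section \<open>Optimality of associated points\<close>

lemma argmin_set_nonempty: "argmin_set V i x \<noteq> {}"
  using ex_is_arg_min_if_finite[of UNIV "\<lambda>k. V i $ k - ereal (x $ k)"]
  by (simp add: argmin_set_def)

lemma argmax_set_nonempty: "argmax_set V i x \<noteq> {}"
proof -
  let ?f = "\<lambda>k. V i $ k - ereal (x $ k)"
  have "Max (range ?f) \<in> range ?f"
    by (rule Max_in) auto
  then obtain j where "?f j = Max (range ?f)"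
    by fastforce
  then have "\<And>k. ?f k \<le> ?f j"
    by simp
  then have "j \<in> argmax_set V i x"
    by (simp add: argmax_set_def is_arg_max_linorder)
  then show ?thesis
    by blast
qed

text \<open>For finite entries the potential inequality says
  \<open>V i $ k - x $ k \<ge> - p\<close>, and tightness says that \<open>j\<close> attains this
  bound. Infinite entries are compared directly.\<close>

lemma tight_Phi_X_arc_in_argmin:
  fixes V :: "'m::finite \<Rightarrow> ereal ^ 'n"
  assumes j: "(Phi i, Node_X j) \<in> arcs_max V"
    and tight: "x $ j - p = arc_cost V c (Phi i, Node_X j)"
    and le: "\<And>k. (Phi i, Node_X k) \<in> arcs_max V \<Longrightarrow> x $ k - p \<le> arc_cost V c (Phi i, Node_X k)"
  shows "j \<in> argmin_set V i x"
proof (cases "V i $ j = -\<infinity>")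
  \<comment> \<open>The entry stays \<open>-\<infinity>\<close> after subtracting
    \<open>x $ j\<close>, hence is least, whatever cost \<open>c\<close> replaces it.\<close>
  case True
  then show ?thesis
    by (simp add: argmin_set_def is_arg_min_linorder)
next
  case False
  \<comment> \<open>An arc to an entry other than \<open>-\<infinity>\<close> exists only if the
    whole row avoids \<open>-\<infinity>\<close>.\<close>
  with j have fin: "\<And>k. V i $ k > -\<infinity>" "V i $ j < \<infinity>"
    by (auto simp: Phi_X_arc_iff)
  have "V i $ j - ereal (x $ j) \<le> V i $ k - ereal (x $ k)" for k
  proof (cases "V i $ k = \<infinity>")
    case True
    then show ?thesis by simp
  next
    case False
    \<comment> \<open>In such a row only entries \<open>\<infinity>\<close> lack an arc, so the
      inequality is available at \<open>k\<close>.\<close>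
    then have "x $ k - p \<le> arc_cost V c (Phi i, Node_X k)"
      using fin by (intro le) (simp add: Phi_X_arc_iff)
    with tight fin(1)[of k] fin(1)[of j] fin(2) False show ?thesis
      by (cases "V i $ k"; cases "V i $ j") (auto simp: arc_cost_def original_cost_def)
  qed
  then show ?thesis
    by (simp add: argmin_set_def is_arg_min_linorder)
qed

text \<open>Mirror image: the cost \<open>- V i $ k\<close> turns the inequality into
  \<open>V i $ k - x $ k \<le> - p\<close>, attained at \<open>j\<close>, and the cost
  \<open>c\<close> now stands for entries \<open>\<infinity>\<close>.\<close>

lemma tight_X_Psi_arc_in_argmax:
  fixes V :: "'m::finite \<Rightarrow> ereal ^ 'n"
  assumes j: "(Node_X j, Psi i) \<in> arcs_min V"
    and tight: "p - x $ j = arc_cost V c (Node_X j, Psi i)"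
    and le: "\<And>k. (Node_X k, Psi i) \<in> arcs_min V \<Longrightarrow> p - x $ k \<le> arc_cost V c (Node_X k, Psi i)"
  shows "j \<in> argmax_set V i x"
proof (cases "V i $ j = \<infinity>")
  case True
  then show ?thesis
    by (simp add: argmax_set_def is_arg_max_linorder)
next
  case False
  with j have fin: "\<And>k. V i $ k < \<infinity>" "V i $ j > -\<infinity>"
    by (auto simp: X_Psi_arc_iff)
  have "V i $ k - ereal (x $ k) \<le> V i $ j - ereal (x $ j)" for k
  proof (cases "V i $ k = -\<infinity>")
    case True
    then show ?thesis by simp
  next
    case False
    then have "p - x $ k \<le> arc_cost V c (Node_X k, Psi i)"
      using fin by (intro le) (simp add: X_Psi_arc_iff)
    with tight fin(1)[of k] fin(1)[of j] fin(2) False show ?thesis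
      by (cases "V i $ k"; cases "V i $ j") (auto simp: arc_cost_def original_cost_def)
  qed
  then show ?thesis
    by (simp add: argmax_set_def is_arg_max_linorder)
qed

text \<open>If \<open>r\<close> has total mass \<open>0\<close>, any element of the hull will do; hence the nonemptiness of \<open>P\<close>.\<close>

lemma mass_in_scaled_hull:
  fixes r :: "'n::finite \<Rightarrow> real"
  assumes "P \<noteq> {}" "\<And>j. 0 \<le> r j" "\<And>j. j \<notin> P \<Longrightarrow> r j = 0"
  shows "\<exists>p. p \<in> convex hull ((\<lambda>j. axis j 1) ` P) \<and> (\<chi> j. r j) = (\<Sum>j\<in>UNIV. r j) *\<^sub>R p"
proof (cases "(\<Sum>j\<in>UNIV. r j) = 0")
  case True
  then have "r j = 0" for j
    using assms(2) by (simp add: sum_nonneg_eq_0_iff)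
  moreover obtain j where "j \<in> P"
    using assms(1) by blast
  ultimately show ?thesis
    by (intro exI[of _ "axis j 1"]) (auto intro: hull_inc simp: vec_eq_iff)
next
  case False
  define s where "s = (\<Sum>j\<in>UNIV. r j)"
  have s: "s > 0" "(\<Sum>j\<in>P. r j) = s"
    using False assms(2,3) sum_nonneg[of UNIV r] sum.mono_neutral_left[of UNIV P r]
    by (auto simp: s_def less_le)
  have "(\<Sum>j\<in>P. (r j / s) *\<^sub>R axis j 1) \<in> convex hull ((\<lambda>j. axis j (1::real)) ` P)"
    using s assms(2)
    by (intro convex_sum) (auto simp: sum_divide_distrib[symmetric] hull_inc)
  moreover have "(\<Sum>j\<in>P. (r j / s) *\<^sub>R axis j 1) $ k = r k / s" for k
    using assms(3) by (simp add: axis_def if_distrib cong: if_cong)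
  ultimately show ?thesis
    using s(1) by (intro exI[of _ "\<Sum>j\<in>P. (r j / s) *\<^sub>R axis j 1"])
      (simp add: vec_eq_iff s_def[symmetric])
qed

text \<open>Convex hulls commute with affine maps and with Minkowski sums, and \<open>j\<close>,
  \<open>j'\<close> range independently, so the generating set is a Minkowski sum.\<close>

lemma convex_hull_axis_differences:
  fixes p q :: "real ^ 'n"
  assumes "p \<in> convex hull ((\<lambda>j. axis j 1) ` P)" "q \<in> convex hull ((\<lambda>j. axis j 1) ` Q)"
  shows "a *\<^sub>R p - b *\<^sub>R q + z
    \<in> convex hull {a *\<^sub>R axis j 1 - b *\<^sub>R axis j' 1 + z | j j'. j \<in> P \<and> j' \<in> Q}"
proof -
  \<comment> \<open>The shift \<open>z\<close> goes into one of the two maps only, so that it is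
    counted once.\<close>
  let ?f = "\<lambda>y::real ^ 'n. a *\<^sub>R y" and ?g = "\<lambda>y::real ^ 'n. z + (- b) *\<^sub>R y"
  have "?f p \<in> convex hull (?f ` (\<lambda>j. axis j 1) ` P)"
    using assms(1) by (simp only: convex_hull_scaling) (rule imageI)
  moreover have "?g q \<in> convex hull (?g ` (\<lambda>j. axis j 1) ` Q)"
    using assms(2) by (simp only: convex_hull_affinity) (rule imageI)
  ultimately have "?f p + ?g q
      \<in> convex hull (?f ` (\<lambda>j. axis j 1) ` P + ?g ` (\<lambda>j. axis j 1) ` Q)"
    by (simp add: convex_hull_set_plus set_plus_intro)
  moreover have "?f ` (\<lambda>j. axis j 1) ` P + ?g ` (\<lambda>j. axis j 1) ` Q
      = {a *\<^sub>R axis j 1 - b *\<^sub>R axis j' 1 + z | j j'. j \<in> P \<and> j' \<in> Q}"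
    by (force simp: set_plus_def algebra_simps)
  ultimately show ?thesis
    by (simp add: algebra_simps)
qed

lemma associated_point_in_FW_set:
  fixes V :: "'m::finite \<Rightarrow> ereal ^ 'n"
  assumes feas: "MCF_feasible V w lam \<rho>" and x: "x \<in> associated_points V c \<rho>"
  shows "torus_class x \<in> FW_set V w lam"
proof -
  obtain \<phi> \<psi> where
    \<phi>: "\<And>i j. (Phi i, Node_X j) \<in> arcs_max V \<Longrightarrow>
           x $ j - \<phi> i \<le> arc_cost V c (Phi i, Node_X j) \<and>
           (\<rho> (Phi i, Node_X j) > 0 \<longrightarrow> x $ j - \<phi> i = arc_cost V c (Phi i, Node_X j))" and
    \<psi>: "\<And>i j. (Node_X j, Psi i) \<in> arcs_min V \<Longrightarrow>
           \<psi> i - x $ j \<le> arc_cost V c (Node_X j, Psi i) \<and>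
           (\<rho> (Node_X j, Psi i) > 0 \<longrightarrow> \<psi> i - x $ j = arc_cost V c (Node_X j, Psi i))"
    using x unfolding associated_points_def by blast
  \<comment> \<open>Extension by zero to all index pairs turns sums over existing arcs into sums
    over \<open>UNIV\<close>.\<close>
  define r where "r i j = (if (Phi i, Node_X j) \<in> arcs_max V then \<rho> (Phi i, Node_X j) else 0)" for i j
  define s where "s i j = (if (Node_X j, Psi i) \<in> arcs_min V then \<rho> (Node_X j, Psi i) else 0)" for i j
  have nonneg: "0 \<le> r i j" "0 \<le> s i j" for i j
    using feas by (auto simp: r_def s_def MCF_feasible_def)
  have r_sum: "(\<Sum>j\<in>UNIV. r i j) = w i * beta TYPE('n) (lam i)"
    and s_sum: "(\<Sum>j\<in>UNIV. s i j) = w i * alpha TYPE('n) (lam i)"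
    and cons: "(\<Sum>i\<in>UNIV. r i j) - (\<Sum>i\<in>UNIV. s i j) = delta_tot w lam" for i j
    using feas by (simp_all add: r_def s_def MCF_feasible_def sum.inter_filter[symmetric])
  \<comment> \<open>Positive flow makes an arc tight, and tight arcs end in minimizers.\<close>
  have r_supp: "r i j = 0" if "j \<notin> argmin_set V i x" for i j
    using that tight_Phi_X_arc_in_argmin[of i j V x "\<phi> i" c] \<phi> nonneg(1)[of i j]
    by (auto simp: r_def less_le split: if_splits)
  have s_supp: "s i j = 0" if "j \<notin> argmax_set V i x" for i j
    using that tight_X_Psi_arc_in_argmax[of j i V "\<psi> i" x c] \<psi> nonneg(2)[of i j]
    by (auto simp: s_def less_le split: if_splits)
  have "\<exists>q. q \<in> convex hull ((\<lambda>j. axis j 1) ` argmin_set V i x)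
          \<and> (\<chi> j. r i j) = (w i * beta TYPE('n) (lam i)) *\<^sub>R q" for i
    using mass_in_scaled_hull[of "argmin_set V i x" "r i", OF argmin_set_nonempty nonneg(1) r_supp]
    by (simp add: r_sum)
  then obtain q where q: "\<And>i. q i \<in> convex hull ((\<lambda>j. axis j 1) ` argmin_set V i x)"
    "\<And>i. (\<chi> j. r i j) = (w i * beta TYPE('n) (lam i)) *\<^sub>R q i"
    by metis
  have "\<exists>p. p \<in> convex hull ((\<lambda>j. axis j 1) ` argmax_set V i x)
          \<and> (\<chi> j. s i j) = (w i * alpha TYPE('n) (lam i)) *\<^sub>R p" for i
    using mass_in_scaled_hull[of "argmax_set V i x" "s i", OF argmax_set_nonempty nonneg(2) s_supp]
    by (simp add: s_sum)
  then obtain p where p: "\<And>i. p i \<in> convex hull ((\<lambda>j. axis j 1) ` argmax_set V i x)"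
    "\<And>i. (\<chi> j. s i j) = (w i * alpha TYPE('n) (lam i)) *\<^sub>R p i"
    by metis
  define u where "u i = alpha TYPE('n) (lam i) *\<^sub>R p i - beta TYPE('n) (lam i) *\<^sub>R q i
                    + delta (lam i) *\<^sub>R 1" for i
  \<comment> \<open>The masses at \<open>Phi i\<close> and \<open>Psi i\<close> already contain the
    factor \<open>w i\<close>, so scaling \<open>u i\<close> by it recovers the flows
    themselves.\<close>
  have "w i *\<^sub>R u i = (\<chi> j. s i j) - (\<chi> j. r i j) + (w i * delta (lam i)) *\<^sub>R 1" for i
    by (simp add: u_def p(2) q(2) algebra_simps)
  then have "(\<Sum>i\<in>UNIV. w i *\<^sub>R u i) $ j
      = (\<Sum>i\<in>UNIV. s i j) - (\<Sum>i\<in>UNIV. r i j) + delta_tot w lam" for j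
    by (simp add: sum.distrib sum_subtractf delta_tot_def)
  then have "(\<Sum>i\<in>UNIV. w i *\<^sub>R u i) = 0"
    using cons by (simp add: vec_eq_iff) (smt (verit))
  \<comment> \<open>An element of a Minkowski sum is a sum of one choice from each summand; here the
    choices are \<open>w i *\<^sub>R u i\<close>.\<close>
  moreover have "(\<Sum>i\<in>UNIV. w i *\<^sub>R u i) \<in> subdiff V w lam x"
    unfolding subdiff_def set_sum_alt[OF finite] u_def
    using convex_hull_axis_differences[OF p(1) q(1)] by blast
  ultimately show ?thesis
    by (simp add: torus_class_in_FW_set_iff)
qed

theorem theorem2:
  fixes V :: "'m::finite \<Rightarrow> ereal ^ 'n"
    and w lam :: "'m \<Rightarrow> real"
    and c :: real
    and \<rho> :: "('m, 'n) arc \<Rightarrow> real"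
  assumes "CARD('n) \<ge> 2"
    and "\<And>i. V i \<noteq> (\<chi> j. \<infinity>)"
    and "\<And>i. V i \<noteq> (\<chi> j. -\<infinity>)"
    and "\<And>i. w i > 0"
    and "\<And>i. lam i \<in> {0..1}"
    and "MCF_optimal V w lam c \<rho>"
  shows "associated_points V c \<rho> \<noteq> {} \<and>
         (\<forall>x\<in>associated_points V c \<rho>. torus_class x \<in> FW_set V w lam)"
proof -
  have "MCF_feasible V w lam \<rho>"
    using assms(6) by (simp add: MCF_optimal_def is_arg_min_def)
  then show ?thesis
    using optimal_flow_has_potentials[OF assms(6)] associated_point_in_FW_set by blast
qed

end
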